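(* Consider solving a discounted infinite horizon Markov decision process with $n_s$ states, $n_a$ actions and discount factor $\theta\in(0,1)$, formulated as the linear program $P$ in the context, by sampling columns. Let $C>0$ be a constant and define $$P_{\mathrm{distr}}:\quad \min\{\mathbf c^T\mathbf x \mid \mathbf A\mathbf x=\mathbf 1,\ \mathbf 0\le \mathbf x\le C\boldsymbol\xi\}.$$ Let $J=\{j_1,\dots,j_K\}$ be drawn i.i.d. from $\boldsymbol\xi$ and let $P_J$ be the column-randomized LP. For any $\delta\in(0,1)$, with probability at least $1-\delta$, the following implication holds: if $P_J$ is feasible and $\mathrm{rank}(\mathbf A_J)=n_s$, then $$\Delta v(P_J)\le\Delta v(P_{\mathrm{distr}})+\frac{C}{\sqrt K}\cdot\left(1+\frac{n_s\|\mathbf c\|_\infty}{1-\theta}\right)\cdot\left(1+\sqrt{2\log\frac2\delta}\right).$$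
   Context: The MDP has immediate costs $c(s,a)$ and transition probabilities $P_s(s',a)\ge0$ (probability of moving to state $s'$ after taking action $a$ in state $s$), with $\sum_{s'}P_s(s',a)=1$ for all $s,a$. Its LP formulation is $$P:\ \min\ \sum_{a=1}^{n_a}\tilde{\mathbf c}_a^T\tilde{\mathbf x}_a\quad\text{s.t.}\quad\sum_{a=1}^{n_a}(\mathbf I-\theta\tilde{\mathbf P}_a)\tilde{\mathbf x}_a=\mathbf 1,\quad\tilde{\mathbf x}_1,\dots,\tilde{\mathbf x}_{n_a}\ge\mathbf 0,$$ where $\tilde{\mathbf x}_a\in\mathbb R^{n_s}$, $\tilde{\mathbf c}_a=(c(1,a),\dots,c(n_s,a))$, $\tilde{\mathbf P}_a$ is the $n_s\times n_s$ matrix whose $(s',s)$ entry is $P_s(s',a)$, and $\mathbf 1$ is the all-ones vector. Write this as $\min\{\mathbf c^T\mathbf x\mid\mathbf A\mathbf x=\mathbf 1,\mathbf x\ge\mathbf 0\}$ with $\mathbf A=[\mathbf I-\theta\tilde{\mathbf P}_1,\dots,\mathbf I-\theta\tilde{\mathbf P}_{n_a}]\in\mathbb R^{n_s\times n}$, $n=n_sn_a$, and $\mathbf c$, $\mathbf x$ the concatenations of the $\tilde{\mathbf c}_a$, $\tilde{\mathbf x}_a$. Standing assumption: $\|\mathbf c\|_2=1$. $\boldsymbol\xi$ is a probability distribution on $[n]=\{1,\dots,n\}$; $j_1,\dots,j_K$ are independent with $\Pr[j_k=t]=\xi_t$ (repetitions possible). $\mathbf A_J$ is the matrix whose columns are columns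 $j_1,\dots,j_K$ of $\mathbf A$, $\mathbf c_J=(c_{j_1},\dots,c_{j_K})$, and $P_J:\ \min\{\mathbf c_J^T\mathbf y\mid\mathbf A_J\mathbf y=\mathbf 1,\ \mathbf y\ge\mathbf 0\}$. $v(\cdot)$ denotes the optimal value, with $v=+\infty$ for an infeasible minimization problem, and $\Delta v(P'')=v(P'')-v(P)$. *)

theory Defs
  imports "HOL-Probability.Probability"
begin

text \<open>The order on vectors is componentwise and
  \<open>1 :: real ^ 'm\<close> is the all-ones vector.\<close>

definition lp_feasible :: "real ^ 'n ^ 'm \<Rightarrow> real ^ 'm \<Rightarrow> (real ^ 'n) set" where
  "lp_feasible A b = {x. A *v x = b \<and> 0 \<le> x}"

definition box_feasible :: "real ^ 'n ^ 'm \<Rightarrow> real ^ 'm \<Rightarrow> real ^ 'n \<Rightarrow> (real ^ 'n) set" where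
  "box_feasible A b u = {x. A *v x = b \<and> 0 \<le> x \<and> x \<le> u}"

text \<open>The infimum over the empty set is \<open>\<infinity>\<close>, as required of an infeasible minimization problem.\<close>

definition lp_value :: "real ^ 'n \<Rightarrow> (real ^ 'n) set \<Rightarrow> ereal" where
  "lp_value c X = (INF x\<in>X. ereal (c \<bullet> x))"

text \<open>\<open>P s a s'\<close> is the probability of moving from \<open>s\<close> to \<open>s'\<close> under action \<open>a\<close>. Columns of the
  stacked matrix \<open>[I - \<theta> P\<^sub>1, \<dots>, I - \<theta> P\<^sub>n]\<close> are indexed by pairs \<open>(a, s)\<close>: block, then
  position inside the block.\<close>

definition trans_matrix :: "('s::finite \<Rightarrow> 'a::finite \<Rightarrow> 's \<Rightarrow> real) \<Rightarrow> 'a \<Rightarrow> real ^ 's ^ 's" where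
  "trans_matrix P a = (\<chi> s' s. P s a s')"

definition mdp_matrix :: "real \<Rightarrow> ('s::finite \<Rightarrow> 'a::finite \<Rightarrow> 's \<Rightarrow> real) \<Rightarrow> real ^ ('a \<times> 's) ^ 's" where
  "mdp_matrix \<theta> P = (\<chi> i t. (mat 1 - \<theta> *\<^sub>R trans_matrix P (fst t)) $ i $ snd t)"

definition mdp_cost :: "('s::finite \<Rightarrow> 'a::finite \<Rightarrow> real) \<Rightarrow> real ^ ('a \<times> 's)" where
  "mdp_cost c = (\<chi> t. c (snd t) (fst t))"

lemma mdp_matrix_mult_blocks:
  fixes P :: "'s::finite \<Rightarrow> 'a::finite \<Rightarrow> 's \<Rightarrow> real"
  shows "mdp_matrix \<theta> P *v x
    = (\<Sum>a\<in>UNIV. (mat 1 - \<theta> *\<^sub>R trans_matrix P a) *v (\<chi> s. x $ (a, s)))"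
  by (simp add: vec_eq_iff mdp_matrix_def matrix_vector_mult_def sum.cartesian_product
      split_def flip: UNIV_Times_UNIV)

text \<open>\<open>j\<close> need not be injective: a column may be sampled repeatedly.\<close>

definition select_columns :: "real ^ 'n ^ 'm \<Rightarrow> ('k \<Rightarrow> 'n) \<Rightarrow> real ^ 'k ^ 'm" where
  "select_columns A j = (\<chi> i k. A $ i $ j k)"

definition select_entries :: "real ^ 'n \<Rightarrow> ('k \<Rightarrow> 'n) \<Rightarrow> real ^ 'k" where
  "select_entries c j = (\<chi> k. c $ j k)"

definition v_P :: "real \<Rightarrow> ('s::finite \<Rightarrow> 'a::finite \<Rightarrow> 's \<Rightarrow> real) \<Rightarrow> ('s \<Rightarrow> 'a \<Rightarrow> real) \<Rightarrow> ereal" where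
  "v_P \<theta> P c = lp_value (mdp_cost c) (lp_feasible (mdp_matrix \<theta> P) 1)"

definition v_distr :: "real \<Rightarrow> ('s::finite \<Rightarrow> 'a::finite \<Rightarrow> 's \<Rightarrow> real) \<Rightarrow> ('s \<Rightarrow> 'a \<Rightarrow> real)
    \<Rightarrow> real \<Rightarrow> real ^ ('a \<times> 's) \<Rightarrow> ereal" where
  "v_distr \<theta> P c C \<xi> = lp_value (mdp_cost c) (box_feasible (mdp_matrix \<theta> P) 1 (C *\<^sub>R \<xi>))"

definition v_sampled :: "real \<Rightarrow> ('s::finite \<Rightarrow> 'a::finite \<Rightarrow> 's \<Rightarrow> real) \<Rightarrow> ('s \<Rightarrow> 'a \<Rightarrow> real)
    \<Rightarrow> ('k::finite \<Rightarrow> 'a \<times> 's) \<Rightarrow> ereal" where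
  "v_sampled \<theta> P c j = lp_value (select_entries (mdp_cost c) j)
     (lp_feasible (select_columns (mdp_matrix \<theta> P) j) 1)"

end

(* An optimal solution x of P_distr gives weights y_k = x_{j_k} / (K \<xi>_{j_k}) for the sampled
   columns, which satisfy A_J y = 1 and c_J y = c x in expectation.  The dual of P_J is a Markov
   decision process with the sampled actions only: feasibility of P_J forces every state to keep an
   action, so the Bellman equation has a solution p with |p| \<le> |c| / (1 - \<theta>) in every component,
   p is dual feasible, and v(P_J) \<le> 1 p because the discounted occupancy of a greedy policy is
   feasible for P_J.  Hence v(P_J) \<le> c_J y + |p| |A_J y - 1|.  Both deviations c_J y - c x and
   A_J y - 1 are averages of independent bounded vectors, so their norms are small in expectation
   by a variance computation, and with high probability by McDiarmid's inequality. *)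

theory Submission
  imports Defs
begin

section \<open>Exponential moments and McDiarmid's inequality for finite product
  distributions\<close>

lemma integrable_measure_pmf_finite_type:
  fixes f :: "'b::finite \<Rightarrow> 'c::{banach, second_countable_topology}"
  shows "integrable (measure_pmf p) f"
  by (rule integrable_measure_pmf_finite) simp

text \<open>Fubini for one coordinate split off the product. Conditioning on that coordinate is the
  induction step both for the exponential moment and for the variance, so neither needs a martingale
  or a filtration.\<close>

lemma expectation_Pi_pmf_insert:
  fixes g :: "('k::finite \<Rightarrow> 't::finite) \<Rightarrow> 'c::{banach, second_countable_topology}"
  assumes "x \<notin> A"
  shows "measure_pmf.expectation (Pi_pmf (insert x A) d p) g
    = measure_pmf.expectation (p x)
        (\<lambda>t. measure_pmf.expectation (Pi_pmf A d p) (\<lambda>f. g (f(x := t))))"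
proof -
  have "measure_pmf.expectation (Pi_pmf (insert x A) d p) g
    = (\<Sum>t\<in>UNIV. pmf (p x) t *\<^sub>R
        measure_pmf.expectation (map_pmf (\<lambda>f. f(x := t)) (Pi_pmf A d p)) g)"
    unfolding Pi_pmf_insert'[OF finite assms] map_pmf_def[symmetric]
    by (rule pmf_expectation_bind) auto
  then show ?thesis
    by (subst integral_measure_pmf[of UNIV]) simp_all
qed

lemma Hoeffdings_lemma_pmf:
  fixes f :: "'t::finite \<Rightarrow> real"
  assumes "0 < l" and width: "\<And>s t. f s - f t \<le> w"
  shows "measure_pmf.expectation p (\<lambda>t. exp (l * (f t - measure_pmf.expectation p f)))
    \<le> exp (l\<^sup>2 * w\<^sup>2 / 8)"
proof -
  \<comment> \<open>An oscillation bound becomes an enclosing interval of length \<open>w\<close>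
    once its left end is a value of \<open>f\<close>; on a finite type the minimum is one.\<close>
  define a where "a = Min (range f)"
  have "a \<in> range f" unfolding a_def by (rule Min_in) auto
  then obtain t\<^sub>0 where "a = f t\<^sub>0" by blast
  moreover have "a \<le> f t" for t unfolding a_def by simp
  ultimately have "f t \<in> {a..a + w}" for t
    using width[of t t\<^sub>0] by simp
  then interpret interval_bounded_random_variable "measure_pmf p" f a "a + w"
    by unfold_locales auto
  have "ennreal (measure_pmf.expectation p (\<lambda>t. exp (l * (f t - measure_pmf.expectation p f))))
    = (\<integral>\<^sup>+t. exp (l * (f t - measure_pmf.expectation p f)) \<partial>p)"
    by (intro nn_integral_eq_integral[symmetric] integrable_measure_pmf_finite_type) simp
  also have "\<dots> \<le> ennreal (exp (l\<^sup>2 * w\<^sup>2 / 8))"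
    using Hoeffdings_lemma_nn_integral[OF \<open>0 < l\<close>] by simp
  finally show ?thesis by simp
qed

text \<open>Induction over the coordinates. With the coordinate \<open>x\<close> frozen at
  \<open>t\<close>, the induction hypothesis bounds the fluctuation of \<open>g\<close> around its
  conditional mean \<open>m t\<close>, uniformly in \<open>t\<close>. The conditional mean itself
  oscillates by at most \<open>w x\<close>, so Hoeffding's lemma handles its fluctuation around
  \<open>e\<close>. The two exponential bounds multiply. Because \<open>f\<close> and
  \<open>t\<close> are arbitrary in the hypothesis, the one-sided difference bound is in effect
  two-sided.\<close>

lemma bounded_differences_mgf:
  fixes g :: "('k::finite \<Rightarrow> 't::finite) \<Rightarrow> real"
  assumes "0 < l"
    and "\<And>f x t. x \<in> A \<Longrightarrow> g (f(x := t)) - g f \<le> w x"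
  shows "measure_pmf.expectation (Pi_pmf A d p)
      (\<lambda>f. exp (l * (g f - measure_pmf.expectation (Pi_pmf A d p) g)))
    \<le> exp (l\<^sup>2 * (\<Sum>x\<in>A. (w x)\<^sup>2) / 8)"
  using finite[of A] assms(2)
proof (induction A arbitrary: g rule: finite_induct)
  case empty
  then show ?case by simp
next
  case (insert x A)
  define E where "E (h :: _ \<Rightarrow> real) = measure_pmf.expectation (Pi_pmf A d p) h" for h
  define m where "m t = E (\<lambda>f. g (f(x := t)))" for t
  define e where "e = measure_pmf.expectation (p x) m"
  note int = integrable_measure_pmf_finite_type
  have e: "measure_pmf.expectation (Pi_pmf (insert x A) d p) g = e"
    unfolding e_def m_def E_def by (rule expectation_Pi_pmf_insert) fact
  have "m s - m t \<le> w x" for s t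
  proof -
    have "m s - m t = E (\<lambda>f. g (f(x := s)) - g (f(x := t)))"
      unfolding m_def E_def by (intro Bochner_Integration.integral_diff[symmetric] int)
    also have "\<dots> \<le> E (\<lambda>f. w x)"
      unfolding E_def
    proof (intro integral_mono int)
      fix f show "g (f(x := s)) - g (f(x := t)) \<le> w x"
        using insert.prems[of x "f(x := t)" s] unfolding fun_upd_upd by blast
    qed
    finally show ?thesis by (simp add: E_def)
  qed
  note outer = Hoeffdings_lemma_pmf[OF \<open>0 < l\<close> this, of "p x"]
  have inner: "E (\<lambda>f. exp (l * (g (f(x := t)) - m t))) \<le> exp (l\<^sup>2 * (\<Sum>y\<in>A. (w y)\<^sup>2) / 8)" for t
    unfolding E_def m_def
  proof (rule insert.IH)
    fix f y s assume "y \<in> A"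
    then have "(f(y := s))(x := t) = (f(x := t))(y := s)"
      using insert.hyps by (auto simp: fun_upd_twist)
    then show "g ((f(y := s))(x := t)) - g (f(x := t)) \<le> w y"
      using insert.prems[of y "f(x := t)" s] \<open>y \<in> A\<close> by (simp del: fun_upd_apply)
  qed
  have "measure_pmf.expectation (Pi_pmf (insert x A) d p) (\<lambda>f. exp (l * (g f - e)))
    = measure_pmf.expectation (p x) (\<lambda>t. E (\<lambda>f. exp (l * (g (f(x := t)) - e))))"
    unfolding E_def by (rule expectation_Pi_pmf_insert) fact
  \<comment> \<open>Split \<open>g - e\<close> at the conditional mean \<open>m t\<close>; the
    factor with \<open>m t - e\<close> does not depend on the remaining coordinates and leaves the
    inner expectation.\<close>
  also have "\<dots> = measure_pmf.expectation (p x)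
      (\<lambda>t. exp (l * (m t - e)) * E (\<lambda>f. exp (l * (g (f(x := t)) - m t))))"
  proof (intro Bochner_Integration.integral_cong refl)
    fix t
    have "exp (l * (g h - e)) = exp (l * (m t - e)) * exp (l * (g h - m t))" for h
      by (simp add: algebra_simps flip: exp_add)
    then show "E (\<lambda>f. exp (l * (g (f(x := t)) - e)))
        = exp (l * (m t - e)) * E (\<lambda>f. exp (l * (g (f(x := t)) - m t)))"
      by (simp add: E_def)
  qed
  also have "\<dots> \<le> measure_pmf.expectation (p x)
      (\<lambda>t. exp (l * (m t - e)) * exp (l\<^sup>2 * (\<Sum>y\<in>A. (w y)\<^sup>2) / 8))"
    by (intro integral_mono int mult_left_mono inner) simp
  also have "\<dots> \<le> exp (l\<^sup>2 * (w x)\<^sup>2 / 8) * exp (l\<^sup>2 * (\<Sum>y\<in>A. (w y)\<^sup>2) / 8)"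
    using outer by (simp add: e_def)
  also have "\<dots> = exp (l\<^sup>2 * (\<Sum>y\<in>insert x A. (w y)\<^sup>2) / 8)"
    using insert.hyps by (simp add: algebra_simps add_divide_distrib flip: exp_add)
  finally show ?case unfolding e .
qed

theorem McDiarmid_ineq_pmf:
  fixes g :: "('k::finite \<Rightarrow> 't::finite) \<Rightarrow> real"
  assumes w: "\<And>f x t. x \<in> A \<Longrightarrow> g (f(x := t)) - g f \<le> w x"
    and pos: "0 < (\<Sum>x\<in>A. (w x)\<^sup>2)" and "0 < \<epsilon>"
  shows "measure_pmf.prob (Pi_pmf A d p)
      {f. g f \<ge> measure_pmf.expectation (Pi_pmf A d p) g + \<epsilon>}
    \<le> exp (- 2 * \<epsilon>\<^sup>2 / (\<Sum>x\<in>A. (w x)\<^sup>2))"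
proof -
  define V where "V = (\<Sum>x\<in>A. (w x)\<^sup>2)"
  \<comment> \<open>This \<open>l\<close> minimizes the Chernoff exponent
    \<open>l^2 * V / 8 - l * \<epsilon>\<close>, whose minimum is
    \<open>- 2 * \<epsilon>^2 / V\<close>.\<close>
  define l where "l = 4 * \<epsilon> / V"
  define e where "e = measure_pmf.expectation (Pi_pmf A d p) g"
  have "0 < V" "0 < l" using pos \<open>0 < \<epsilon>\<close> by (simp_all add: V_def l_def)
  have "{f. g f \<ge> e + \<epsilon>} = {f \<in> space (measure_pmf (Pi_pmf A d p)). exp (l * (g f - e)) \<ge> exp (l * \<epsilon>)}"
    using \<open>0 < l\<close> by auto
  then have "measure_pmf.prob (Pi_pmf A d p) {f. g f \<ge> e + \<epsilon>}
    \<le> measure_pmf.expectation (Pi_pmf A d p) (\<lambda>f. exp (l * (g f - e))) / exp (l * \<epsilon>)"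
    using integral_Markov_inequality_measure[of "measure_pmf (Pi_pmf A d p)"
        "\<lambda>f. exp (l * (g f - e))" UNIV "exp (l * \<epsilon>)"]
    by (simp add: integrable_measure_pmf_finite_type)
  also have "\<dots> \<le> exp (l\<^sup>2 * V / 8) / exp (l * \<epsilon>)"
    unfolding V_def e_def
    by (intro divide_right_mono bounded_differences_mgf w) (use \<open>0 < l\<close> in simp_all)
  also have "\<dots> = exp (- 2 * \<epsilon>\<^sup>2 / V)"
    using \<open>0 < V\<close>
    by (simp add: l_def field_simps power2_eq_square flip: exp_diff)
  finally show ?thesis by (simp add: V_def e_def)
qed

section \<open>Averages of independent vectors: mean square, transfer from the sample space,
  concentration\<close>

lemma expectation_square_norm_sum_Pi_pmf:
  fixes u :: "'t::finite \<Rightarrow> 'v::euclidean_space"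
  assumes mean: "measure_pmf.expectation q u = 0"
  shows "measure_pmf.expectation (Pi_pmf (A :: 'k::finite set) d (\<lambda>_. q))
      (\<lambda>f. (norm (\<Sum>k\<in>A. u (f k)))\<^sup>2)
    = real (card A) * measure_pmf.expectation q (\<lambda>t. (norm (u t))\<^sup>2)"
  using finite[of A]
proof (induction A rule: finite_induct)
  case empty
  then show ?case by simp
next
  case (insert x A)
  define E where "E (h :: _ \<Rightarrow> real) = measure_pmf.expectation (Pi_pmf A d (\<lambda>_. q)) h" for h
  define S where "S f = (\<Sum>k\<in>A. u (f k))" for f
  note int = integrable_measure_pmf_finite_type
  have "measure_pmf.expectation (Pi_pmf (insert x A) d (\<lambda>_. q))
      (\<lambda>f. (norm (\<Sum>k\<in>insert x A. u (f k)))\<^sup>2)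
    = measure_pmf.expectation q
        (\<lambda>t. E (\<lambda>f. (norm (\<Sum>k\<in>insert x A. u ((f(x := t)) k)))\<^sup>2))"
    unfolding E_def by (rule expectation_Pi_pmf_insert) fact
  \<comment> \<open>Expand the square of \<open>u t + S f\<close>. By independence the cross term
    pairs \<open>u t\<close> with the mean of \<open>S\<close>, a fixed vector, so averaging over
    \<open>t\<close> removes it because \<open>u\<close> is centered.\<close>
  also have "\<dots> = measure_pmf.expectation q
      (\<lambda>t. (norm (u t))\<^sup>2 + 2 * (u t \<bullet> measure_pmf.expectation (Pi_pmf A d (\<lambda>_. q)) S)
        + E (\<lambda>f. (norm (S f))\<^sup>2))"
  proof (intro Bochner_Integration.integral_cong refl)
    fix t
    have "(\<Sum>k\<in>insert x A. u ((f(x := t)) k)) = u t + S f" for f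
      using insert.hyps unfolding S_def by (simp, intro sum.cong) auto
    then have "(norm (\<Sum>k\<in>insert x A. u ((f(x := t)) k)))\<^sup>2
        = (norm (u t))\<^sup>2 + 2 * (u t \<bullet> S f) + (norm (S f))\<^sup>2" for f
      by (simp add: power2_norm_eq_inner inner_add inner_commute algebra_simps)
    then show "E (\<lambda>f. (norm (\<Sum>k\<in>insert x A. u ((f(x := t)) k)))\<^sup>2)
      = (norm (u t))\<^sup>2 + 2 * (u t \<bullet> measure_pmf.expectation (Pi_pmf A d (\<lambda>_. q)) S)
        + E (\<lambda>f. (norm (S f))\<^sup>2)"
      by (simp add: E_def Bochner_Integration.integral_add int)
  qed
  also have "\<dots> = measure_pmf.expectation q (\<lambda>t. (norm (u t))\<^sup>2) + E (\<lambda>f. (norm (S f))\<^sup>2)"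
    by (simp add: Bochner_Integration.integral_add int mean)
  finally show ?case
    using insert by (simp add: E_def S_def algebra_simps)
qed

text \<open>The centered summands have second moment at most that of \<open>u\<close>, hence at most
  \<open>R^2\<close>; their squared norms add up over the \<open>K\<close> samples, and dividing by
  \<open>K^2\<close> leaves \<open>R^2 / K\<close>. Nonnegativity of the variance of the deviation
  \<open>D\<close> then bounds its mean by the root of its second moment.\<close>

lemma expectation_norm_mean_deviation_le:
  fixes u :: "'t::finite \<Rightarrow> 'v::euclidean_space"
  assumes bound: "\<And>t. norm (u t) \<le> R"
  shows "measure_pmf.expectation (Pi_pmf (UNIV :: 'k::finite set) d (\<lambda>_. q))
      (\<lambda>f. norm ((\<Sum>k\<in>UNIV. u (f k)) /\<^sub>R real CARD('k) - measure_pmf.expectation q u))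
    \<le> R / sqrt (real CARD('k))"
proof -
  define K where "K = real CARD('k)"
  define \<mu> where "\<mu> = measure_pmf.expectation q u"
  define D where "D f = norm ((\<Sum>k\<in>UNIV. u (f k)) /\<^sub>R K - \<mu>)" for f :: "'k \<Rightarrow> 't"
  define E where "E (h :: _ \<Rightarrow> real) = measure_pmf.expectation (Pi_pmf UNIV d (\<lambda>_. q)) h"
    for h :: "('k \<Rightarrow> 't) \<Rightarrow> real"
  note int = integrable_measure_pmf_finite_type
  have "0 < K" by (simp add: K_def)
  have "0 \<le> R" using norm_ge_zero bound order_trans by blast
  have mean: "measure_pmf.expectation q (\<lambda>t. u t - \<mu>) = 0"
    by (simp add: \<mu>_def Bochner_Integration.integral_diff int)
  have "(norm (u t - \<mu>))\<^sup>2 = (norm (u t))\<^sup>2 - 2 * (u t \<bullet> \<mu>) + (norm \<mu>)\<^sup>2" for t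
    by (simp add: power2_norm_eq_inner inner_diff inner_commute algebra_simps)
  then have "measure_pmf.expectation q (\<lambda>t. (norm (u t - \<mu>))\<^sup>2)
    = measure_pmf.expectation q (\<lambda>t. (norm (u t))\<^sup>2) - 2 * (\<mu> \<bullet> \<mu>) + (norm \<mu>)\<^sup>2"
    by (simp add: Bochner_Integration.integral_diff Bochner_Integration.integral_add int flip: \<mu>_def)
  also have "\<dots> \<le> measure_pmf.expectation q (\<lambda>t. (norm (u t))\<^sup>2)"
    by (simp add: power2_norm_eq_inner)
  also have "\<dots> \<le> measure_pmf.expectation q (\<lambda>t. R\<^sup>2)"
    by (intro integral_mono int power_mono bound) simp
  finally have var: "measure_pmf.expectation q (\<lambda>t. (norm (u t - \<mu>))\<^sup>2) \<le> R\<^sup>2" by simp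
  have "D f = norm (\<Sum>k\<in>UNIV. u (f k) - \<mu>) / K" for f
  proof -
    have "(\<Sum>k\<in>UNIV. u (f k)) /\<^sub>R K - \<mu> = (\<Sum>k\<in>UNIV. u (f k) - \<mu>) /\<^sub>R K"
      using \<open>0 < K\<close> by (simp add: sum_subtractf scaleR_diff_right K_def sum_constant_scaleR)
    then show ?thesis using \<open>0 < K\<close> by (simp add: D_def field_simps)
  qed
  then have "E (\<lambda>f. (D f)\<^sup>2) = E (\<lambda>f. (norm (\<Sum>k\<in>UNIV. u (f k) - \<mu>))\<^sup>2) / K\<^sup>2"
    by (simp add: E_def power_divide)
  also have "\<dots> = (K * measure_pmf.expectation q (\<lambda>t. (norm (u t - \<mu>))\<^sup>2)) / K\<^sup>2"
    unfolding E_def K_def expectation_square_norm_sum_Pi_pmf[OF mean] by simp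
  also have "\<dots> \<le> K * R\<^sup>2 / K\<^sup>2"
    by (intro divide_right_mono mult_left_mono var) (use \<open>0 < K\<close> in auto)
  also have "\<dots> = R\<^sup>2 / K" using \<open>0 < K\<close> by (simp add: power2_eq_square)
  finally have D2: "E (\<lambda>f. (D f)\<^sup>2) \<le> R\<^sup>2 / K" .
  have "0 \<le> E (\<lambda>f. (D f - E D)\<^sup>2)" unfolding E_def by simp
  also have "\<dots> = E (\<lambda>f. (D f)\<^sup>2) - (E D)\<^sup>2"
    unfolding E_def by (intro measure_pmf.variance_eq int)
  finally have "(E D)\<^sup>2 \<le> R\<^sup>2 / K" using D2 by simp
  then have "E D \<le> sqrt (R\<^sup>2 / K)" by (rule real_le_rsqrt)
  then show ?thesis
    using \<open>0 \<le> R\<close> by (simp add: real_sqrt_divide E_def D_def[abs_def] K_def \<mu>_def)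
qed

text \<open>The samples live on an arbitrary probability space, but only their joint law matters.
  All types are finite, so an event about the samples is a finite disjoint union of the sets
  \<open>B f\<close> on which the whole sample vector equals \<open>f\<close>, and independence
  turns each of their probabilities into a product.\<close>

lemma (in prob_space) indep_vars_prob_eq_Pi_pmf:
  fixes j :: "'k::finite \<Rightarrow> 'a \<Rightarrow> 't::finite"
  assumes indep: "indep_vars (\<lambda>_. count_space UNIV) j UNIV"
    and law: "\<And>k t. prob {\<omega> \<in> space M. j k \<omega> = t} = pmf (p k) t"
  shows "prob {\<omega> \<in> space M. Q (\<lambda>k. j k \<omega>)} = measure_pmf.prob (Pi_pmf UNIV d p) {f. Q f}"
proof -
  have meas: "j k \<in> measurable M (count_space UNIV)" for k
    using indep by (auto simp: indep_vars_def)
  define B where "B f = {\<omega> \<in> space M. \<forall>k. j k \<omega> = f k}" for f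
  have B_eq: "B f = (\<Inter>k\<in>UNIV. j k -` {f k} \<inter> space M)" for f
    by (auto simp: B_def)
  have B: "B f \<in> events" for f
    unfolding B_eq by (intro sets.finite_INT measurable_sets[OF meas]) auto
  have pB: "prob (B f) = pmf (Pi_pmf UNIV d p) f" for f
  proof -
    have "prob (B f) = (\<Prod>k\<in>UNIV. prob (j k -` {f k} \<inter> space M))"
      unfolding B_eq by (rule indep_varsD_finite[OF indep]) auto
    also have "\<dots> = (\<Prod>k\<in>UNIV. pmf (p k) (f k))"
      by (intro prod.cong refl) (simp add: vimage_def Int_def conj_commute flip: law)
    finally show ?thesis by (simp add: pmf_Pi)
  qed
  have "{\<omega> \<in> space M. Q (\<lambda>k. j k \<omega>)} = (\<Union>f\<in>{f. Q f}. B f)"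
    by (auto simp: B_def)
  also have "prob \<dots> = (\<Sum>f\<in>{f. Q f}. prob (B f))"
    by (intro finite_measure_finite_Union) (auto simp: disjoint_family_on_def B, auto simp: B_def)
  also have "\<dots> = measure_pmf.prob (Pi_pmf UNIV d p) {f. Q f}"
    unfolding pB by (simp add: measure_measure_pmf_finite)
  finally show ?thesis .
qed

lemma mean_deviation_bounded_difference:
  fixes u :: "'t \<Rightarrow> 'v::real_normed_vector" and f :: "'k::finite \<Rightarrow> 't"
  assumes bound: "\<And>t. norm (u t) \<le> R"
  shows "norm ((\<Sum>k\<in>UNIV. u ((f(x := t)) k)) /\<^sub>R real CARD('k) - a)
      - norm ((\<Sum>k\<in>UNIV. u (f k)) /\<^sub>R real CARD('k) - a)
    \<le> 2 * R / real CARD('k)"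
proof -
  have "(\<Sum>k\<in>UNIV. u ((f(x := t)) k)) - (\<Sum>k\<in>UNIV. u (f k))
    = (\<Sum>k\<in>UNIV. if k = x then u t - u (f x) else 0)"
    unfolding sum_subtractf[symmetric] by (intro sum.cong) auto
  then have diff: "(\<Sum>k\<in>UNIV. u ((f(x := t)) k)) - (\<Sum>k\<in>UNIV. u (f k)) = u t - u (f x)"
    by simp
  have "norm ((\<Sum>k\<in>UNIV. u ((f(x := t)) k)) /\<^sub>R real CARD('k) - a)
      - norm ((\<Sum>k\<in>UNIV. u (f k)) /\<^sub>R real CARD('k) - a)
    \<le> norm (((\<Sum>k\<in>UNIV. u ((f(x := t)) k)) - (\<Sum>k\<in>UNIV. u (f k))) /\<^sub>R real CARD('k))"
    using norm_triangle_ineq2[of "(\<Sum>k\<in>UNIV. u ((f(x := t)) k)) /\<^sub>R real CARD('k) - a"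
        "(\<Sum>k\<in>UNIV. u (f k)) /\<^sub>R real CARD('k) - a"]
    by (simp add: scaleR_diff_right)
  also have "\<dots> = norm (u t - u (f x)) / real CARD('k)"
    unfolding diff by (simp add: divide_inverse_commute)
  also have "\<dots> \<le> 2 * R / real CARD('k)"
    using norm_triangle_ineq4[of "u t" "u (f x)"] bound[of t] bound[of "f x"]
    by (intro divide_right_mono) auto
  finally show ?thesis .
qed

text \<open>McDiarmid's inequality is applied once, to the weighted sum of the two deviations,
  instead of once to each: the sum again has bounded differences, with the widths added, so no union
  bound is spent.\<close>

lemma mean_deviations_concentration:
  fixes u :: "'t::finite \<Rightarrow> 'v::euclidean_space" and v :: "'t \<Rightarrow> 'w::euclidean_space"
  assumes u: "\<And>t. norm (u t) \<le> R" and v: "\<And>t. norm (v t) \<le> R'"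
    and "0 \<le> \<gamma>" "0 < R + \<gamma> * R'" "0 < \<delta>" "\<delta> < 1"
  shows "measure_pmf.prob (Pi_pmf (UNIV :: 'k::finite set) d (\<lambda>_. q))
    {f. norm ((\<Sum>k\<in>UNIV. u (f k)) /\<^sub>R real CARD('k) - measure_pmf.expectation q u)
        + \<gamma> * norm ((\<Sum>k\<in>UNIV. v (f k)) /\<^sub>R real CARD('k) - measure_pmf.expectation q v)
      < (R + \<gamma> * R') / sqrt (real CARD('k)) * (1 + sqrt (2 * ln (1 / \<delta>)))} \<ge> 1 - \<delta>"
proof -
  define K where "K = real CARD('k)"
  define S where "S = R + \<gamma> * R'"
  \<comment> \<open>Replacing one sample changes \<open>F\<close> by at most
    \<open>2 * S / K\<close>, so the squared widths sum to \<open>4 * S^2 / K\<close>; this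
    \<epsilon> makes McDiarmid's bound equal to \<delta>. The summand 1 next to the square root in
    the claim comes from the mean of \<open>F\<close>, at most \<open>S / sqrt K\<close>.\<close>
  define \<epsilon> where "\<epsilon> = S / sqrt K * sqrt (2 * ln (1 / \<delta>))"
  define D where "D f = norm ((\<Sum>k\<in>UNIV. u (f k)) /\<^sub>R K - measure_pmf.expectation q u)"
    for f :: "'k \<Rightarrow> 't"
  define D' where "D' f = norm ((\<Sum>k\<in>UNIV. v (f k)) /\<^sub>R K - measure_pmf.expectation q v)"
    for f :: "'k \<Rightarrow> 't"
  define F where "F f = D f + \<gamma> * D' f" for f
  let ?p = "Pi_pmf (UNIV :: 'k set) d (\<lambda>_. q)"
  have "0 < K" "0 < S" using assms by (simp_all add: K_def S_def)
  have ln: "0 < ln (1 / \<delta>)" using assms by simp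
  have "0 < \<epsilon>" unfolding \<epsilon>_def using \<open>0 < K\<close> \<open>0 < S\<close> ln by (intro mult_pos_pos divide_pos_pos) auto
  have "F (f(x := t)) - F f \<le> 2 * S / K" for f x t
  proof -
    have "D (f(x := t)) - D f \<le> 2 * R / K"
      unfolding D_def K_def by (rule mean_deviation_bounded_difference[OF u])
    moreover have "D' (f(x := t)) - D' f \<le> 2 * R' / K"
      unfolding D'_def K_def by (rule mean_deviation_bounded_difference[OF v])
    then have "\<gamma> * (D' (f(x := t)) - D' f) \<le> \<gamma> * (2 * R' / K)"
      using \<open>0 \<le> \<gamma>\<close> by (rule mult_left_mono)
    ultimately show ?thesis
      by (simp add: F_def S_def algebra_simps add_divide_distrib)
  qed
  moreover have V: "(\<Sum>x\<in>(UNIV :: 'k set). (2 * S / K)\<^sup>2) = 4 * S\<^sup>2 / K"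
    using \<open>0 < K\<close> by (simp add: power2_eq_square flip: K_def)
  moreover have "0 < 4 * S\<^sup>2 / K" using \<open>0 < K\<close> \<open>0 < S\<close> by simp
  ultimately have "measure_pmf.prob ?p {f. F f \<ge> measure_pmf.expectation ?p F + \<epsilon>}
      \<le> exp (- 2 * \<epsilon>\<^sup>2 / (4 * S\<^sup>2 / K))"
    using McDiarmid_ineq_pmf[of UNIV F "\<lambda>_. 2 * S / K" \<epsilon> d "\<lambda>_. q"] \<open>0 < \<epsilon>\<close> by simp
  also have "- 2 * \<epsilon>\<^sup>2 / (4 * S\<^sup>2 / K) = - ln (1 / \<delta>)"
    unfolding \<epsilon>_def power_mult_distrib power_divide
    using \<open>0 < K\<close> \<open>0 < S\<close> ln by (simp add: power2_eq_square)
  also have "exp (- ln (1 / \<delta>)) = \<delta>" using assms by (simp add: ln_div)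
  finally have "measure_pmf.prob ?p {f. F f \<ge> measure_pmf.expectation ?p F + \<epsilon>} \<le> \<delta>" .
  moreover have "measure_pmf.prob ?p {f. F f \<ge> measure_pmf.expectation ?p F + \<epsilon>}
      = 1 - measure_pmf.prob ?p {f. F f < measure_pmf.expectation ?p F + \<epsilon>}"
    by (subst measure_pmf.prob_compl[symmetric]) (auto intro!: arg_cong[of _ _ "measure_pmf.prob ?p"])
  ultimately have "1 - \<delta> \<le> measure_pmf.prob ?p {f. F f < measure_pmf.expectation ?p F + \<epsilon>}"
    by linarith
  also have "\<dots> \<le> measure_pmf.prob ?p {f. F f < S / sqrt K * (1 + sqrt (2 * ln (1 / \<delta>)))}"
  proof -
    have "measure_pmf.expectation ?p F
        = measure_pmf.expectation ?p D + \<gamma> * measure_pmf.expectation ?p D'"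
      unfolding F_def
      by (simp add: Bochner_Integration.integral_add integrable_measure_pmf_finite_type)
    also have "\<dots> \<le> R / sqrt K + \<gamma> * (R' / sqrt K)"
      unfolding D_def[abs_def] D'_def[abs_def] K_def
      by (intro add_mono mult_left_mono expectation_norm_mean_deviation_le u v \<open>0 \<le> \<gamma>\<close>)
    finally have "measure_pmf.expectation ?p F + \<epsilon> \<le> S / sqrt K * (1 + sqrt (2 * ln (1 / \<delta>)))"
      by (simp add: \<epsilon>_def S_def algebra_simps add_divide_distrib)
    then show ?thesis by (intro measure_pmf.finite_measure_mono) auto
  qed
  finally show ?thesis by (simp add: F_def D_def D'_def S_def K_def)
qed

section \<open>Attainment of the box-constrained optimum and extended real arithmetic\<close>

lemma v_distr_attained:
  assumes "box_feasible (mdp_matrix \<theta> P) 1 (C *\<^sub>R \<xi>) \<noteq> {}"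
  obtains x where "x \<in> box_feasible (mdp_matrix \<theta> P) 1 (C *\<^sub>R \<xi>)"
    and "v_distr \<theta> P c C \<xi> = ereal (mdp_cost c \<bullet> x)"
proof -
  let ?X = "box_feasible (mdp_matrix \<theta> P) 1 (C *\<^sub>R \<xi>)"
  \<comment> \<open>A closed slice of a box is compact, so the linear objective attains its
    minimum.\<close>
  have "?X = cbox 0 (C *\<^sub>R \<xi>) \<inter> {x. mdp_matrix \<theta> P *v x = 1}"
    by (auto simp: box_feasible_def mem_box_cart less_eq_vec_def)
  moreover have "closed {x. mdp_matrix \<theta> P *v x = 1}"
    by (intro closed_Collect_eq continuous_intros
        linear_continuous_on linear_linear[THEN iffD2] matrix_vector_mul_linear)
  ultimately have "compact ?X" by (simp add: compact_Int_closed)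
  then obtain x where x: "x \<in> ?X" "\<And>y. y \<in> ?X \<Longrightarrow> mdp_cost c \<bullet> x \<le> mdp_cost c \<bullet> y"
    using continuous_attains_inf[OF _ assms, of "\<lambda>x. mdp_cost c \<bullet> x"]
      continuous_on_inner[OF continuous_on_const continuous_on_id]
    by metis
  then have "v_distr \<theta> P c C \<xi> = ereal (mdp_cost c \<bullet> x)"
    unfolding v_distr_def lp_value_def by (intro antisym INF_lower2[of x] INF_greatest) auto
  then show ?thesis using x(1) that by blast
qed

text \<open>Allows v(P) to be subtracted on both sides without first showing that it is finite; the
  conventions of \<open>ereal\<close> make the infinite cases hold too.\<close>

lemma ereal_minus_le_minus_add:
  fixes a b v :: ereal
  assumes "a \<le> b + ereal r"
  shows "a - v \<le> (b - v) + ereal r"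
  using assms by (cases a; cases b; cases v) auto

section \<open>Fixed points: the Bellman equation and discounted occupancies\<close>

lemma continuous_on_Min_image:
  fixes f :: "'i \<Rightarrow> 'x::topological_space \<Rightarrow> 'y::linorder_topology"
  assumes "finite I" "I \<noteq> {}" "\<And>i. i \<in> I \<Longrightarrow> continuous_on S (f i)"
  shows "continuous_on S (\<lambda>x. Min ((\<lambda>i. f i x) ` I))"
  using assms
proof (induction I rule: finite_ne_induct)
  case (singleton i)
  then show ?case by simp
next
  case (insert i I)
  then show ?case by (auto intro!: continuous_on_min)
qed

lemma stochastic_average_bounds:
  fixes Q h :: "'s::finite \<Rightarrow> real"
  assumes "\<And>s. 0 \<le> Q s" "(\<Sum>s\<in>UNIV. Q s) = 1" "\<And>s. \<bar>h s\<bar> \<le> L"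
  shows "\<bar>\<Sum>s\<in>UNIV. Q s * h s\<bar> \<le> L"
proof -
  have "\<bar>\<Sum>s\<in>UNIV. Q s * h s\<bar> \<le> (\<Sum>s\<in>UNIV. Q s * L)"
    by (intro order_trans[OF sum_abs] sum_mono) (simp add: abs_mult assms mult_left_mono)
  then show ?thesis by (simp add: assms flip: sum_distrib_right)
qed

text \<open>Index \<open>k\<close> stands for a sampled action, available in the state
  \<open>st k\<close>; surjectivity of \<open>st\<close> makes every minimum in the Bellman operator
  \<open>T\<close> range over a nonempty set. The radius \<open>L = b / (1 - \<theta>)\<close>
  solves \<open>b + \<theta> * L = L\<close>, so \<open>T\<close> maps the box of that radius into
  itself. Brouwer's theorem then gives the fixed point and its bound together, and \<pi> picks a
  minimizing action in each state.\<close>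

lemma Bellman_equation:
  fixes st :: "'k::finite \<Rightarrow> 's::finite" and r :: "'k \<Rightarrow> real" and Q :: "'k \<Rightarrow> 's \<Rightarrow> real"
  assumes "surj st"
    and Q: "\<And>k s. 0 \<le> Q k s" "\<And>k. (\<Sum>s\<in>UNIV. Q k s) = 1"
    and \<theta>: "0 < \<theta>" "\<theta> < 1"
    and r: "\<And>k. \<bar>r k\<bar> \<le> b"
  obtains p :: "real ^ 's" and \<pi> :: "'s \<Rightarrow> 'k"
  where "\<And>s. st (\<pi> s) = s"
    and "\<And>s. p $ s = r (\<pi> s) + \<theta> * (\<Sum>s'\<in>UNIV. Q (\<pi> s) s' * p $ s')"
    and "\<And>k. p $ st k \<le> r k + \<theta> * (\<Sum>s'\<in>UNIV. Q k s' * p $ s')"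
    and "\<And>s. \<bar>p $ s\<bar> \<le> b / (1 - \<theta>)"
proof -
  define L where "L = b / (1 - \<theta>)"
  define q where "q k p = r k + \<theta> * (\<Sum>s'\<in>UNIV. Q k s' * p $ s')" for k and p :: "real ^ 's"
  define A where "A s = st -` {s}" for s
  define T where "T p = (\<chi> s. Min ((\<lambda>k. q k p) ` A s))" for p
  define S :: "(real ^ 's) set" where "S = cbox (\<chi> i. - L) (\<chi> i. L)"
  have S: "p \<in> S \<longleftrightarrow> (\<forall>s. \<bar>p $ s\<bar> \<le> L)" for p
    by (auto simp: S_def mem_box_cart abs_le_iff minus_le_iff)
  have A: "A s \<noteq> {}" "finite (A s)" for s
    using surjD[OF \<open>surj st\<close>, of s] by (auto simp: A_def)
  have "0 \<le> b" using r[of undefined] by linarith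
  then have "0 \<le> L" using \<theta> by (simp add: L_def)
  have L: "b + \<theta> * L = L" using \<theta> by (simp add: L_def field_simps)
  have q: "\<bar>q k p\<bar> \<le> L" if "p \<in> S" for k p
  proof -
    have "\<bar>\<Sum>s'\<in>UNIV. Q k s' * p $ s'\<bar> \<le> L"
      by (intro stochastic_average_bounds Q) (use that S in auto)
    then have "\<bar>\<theta> * (\<Sum>s'\<in>UNIV. Q k s' * p $ s')\<bar> \<le> \<theta> * L"
      using \<theta> by (simp add: abs_mult)
    then show ?thesis using r[of k] L unfolding q_def by linarith
  qed
  have T: "\<exists>k\<in>A s. T p $ s = q k p" for p s
  proof -
    have "Min ((\<lambda>k. q k p) ` A s) \<in> (\<lambda>k. q k p) ` A s"
      using A by (intro Min_in) auto
    then show ?thesis by (auto simp: T_def)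
  qed
  obtain p where p: "p \<in> S" "T p = p"
  proof (rule brouwer[of S T])
    show "compact S" "convex S" by (simp_all add: S_def)
    have "0 \<in> S" using \<open>0 \<le> L\<close> by (simp add: S)
    then show "S \<noteq> {}" by blast
    show "continuous_on S T"
      unfolding T_def q_def
      by (intro continuous_on_vec_lambda continuous_on_Min_image continuous_intros A)
    show "T \<in> S \<rightarrow> S"
    proof
      fix p assume "p \<in> S"
      then have "\<bar>T p $ s\<bar> \<le> L" for s
        using T[of s p] q by auto
      then show "T p \<in> S" by (simp add: S)
    qed
  qed auto
  have "\<exists>k. st k = s \<and> p $ s = q k p" for s
    using T[of s p] p by (auto simp: A_def)
  then obtain \<pi> where \<pi>: "\<And>s. st (\<pi> s) = s \<and> p $ s = q (\<pi> s) p" by metis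
  have "p $ st k \<le> q k p" for k
  proof -
    have "Min ((\<lambda>k. q k p) ` A (st k)) \<le> q k p"
      using A by (intro Min_le) (auto simp: A_def)
    then have "T p $ st k \<le> q k p" by (simp add: T_def)
    then show ?thesis using p by simp
  qed
  moreover have "\<bar>p $ s\<bar> \<le> b / (1 - \<theta>)" for s
    using p(1) by (simp add: S L_def)
  ultimately show ?thesis
    using \<pi> unfolding q_def by (intro that[of \<pi> p]) blast+
qed

text \<open>\<open>x $ i\<close> is the expected discounted number of visits to \<open>i\<close>
  when the chain starts with mass 1 in every state. Its defining map preserves nonnegativity, and
  since the rows of \<open>Q\<close> sum to 1 it sends total mass \<open>m\<close> to
  \<open>n_s + \<theta> * m\<close>. Hence mass at most \<open>N = n_s / (1 - \<theta>)\<close> is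
  preserved, and Brouwer's theorem applies on that compact convex set.\<close>

lemma discounted_occupancy_exists:
  fixes Q :: "'s::finite \<Rightarrow> 's \<Rightarrow> real"
  assumes Q: "\<And>s i. 0 \<le> Q s i" "\<And>s. (\<Sum>i\<in>UNIV. Q s i) = 1"
    and \<theta>: "0 < \<theta>" "\<theta> < 1"
  obtains x :: "real ^ 's"
  where "\<And>i. 0 \<le> x $ i" "\<And>i. x $ i = 1 + \<theta> * (\<Sum>s\<in>UNIV. Q s i * x $ s)"
proof -
  define N where "N = real CARD('s) / (1 - \<theta>)"
  define S where "S = {x :: real ^ 's. (\<forall>i. 0 \<le> x $ i) \<and> (\<Sum>i\<in>UNIV. x $ i) \<le> N}"
  define T where "T x = (\<chi> i. 1 + \<theta> * (\<Sum>s\<in>UNIV. Q s i * x $ s))" for x :: "real ^ 's"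
  have N: "real CARD('s) + \<theta> * N = N" using \<theta> by (simp add: N_def field_simps)
  obtain x where x: "x \<in> S" "T x = x"
  proof (rule brouwer[of S T])
    have "closed S"
      unfolding S_def
      by (intro closed_Collect_conj closed_Collect_all closed_Collect_le continuous_intros)
    moreover have "bounded S"
    proof (rule boundedI)
      fix x assume "x \<in> S"
      then show "norm x \<le> N"
        using norm_le_l1_cart[of x] by (simp add: S_def)
    qed
    ultimately show "compact S" by (simp add: compact_eq_bounded_closed)
    show "convex S"
    proof (rule convexI)
      fix x y :: "real ^ 's" and u v :: real
      assume *: "x \<in> S" "y \<in> S" "0 \<le> u" "0 \<le> v" "u + v = 1"
      then have "u * (\<Sum>i\<in>UNIV. x $ i) + v * (\<Sum>i\<in>UNIV. y $ i) \<le> N"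
        by (intro convex_bound_le) (auto simp: S_def)
      then show "u *\<^sub>R x + v *\<^sub>R y \<in> S"
        using * by (simp add: S_def sum.distrib sum_distrib_left)
    qed
    have "0 \<in> S" using \<theta> by (simp add: S_def N_def)
    then show "S \<noteq> {}" by blast
    show "continuous_on S T"
      unfolding T_def by (intro continuous_on_vec_lambda continuous_intros)
    show "T \<in> S \<rightarrow> S"
    proof
      fix x assume x: "x \<in> S"
      have "(\<Sum>i\<in>UNIV. \<Sum>s\<in>UNIV. Q s i * x $ s) = (\<Sum>s\<in>UNIV. x $ s)"
        by (subst sum.swap) (simp add: Q flip: sum_distrib_right)
      then have "(\<Sum>i\<in>UNIV. T x $ i) = real CARD('s) + \<theta> * (\<Sum>s\<in>UNIV. x $ s)"
        by (simp add: T_def sum.distrib flip: sum_distrib_left)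
      also have "\<dots> \<le> real CARD('s) + \<theta> * N"
        using x \<theta> by (simp add: S_def)
      finally have "(\<Sum>i\<in>UNIV. T x $ i) \<le> N" by (simp add: N)
      moreover have "0 \<le> T x $ i" for i
        using x Q \<theta> by (auto simp: T_def S_def intro!: add_nonneg_nonneg mult_nonneg_nonneg sum_nonneg)
      ultimately show "T x \<in> S" by (simp add: S_def)
    qed
  qed auto
  have "x $ i = 1 + \<theta> * (\<Sum>s\<in>UNIV. Q s i * x $ s)" for i
    using arg_cong[OF x(2), of "\<lambda>y. y $ i"] by (simp add: T_def)
  moreover have "0 \<le> x $ i" for i using x(1) by (simp add: S_def)
  ultimately show ?thesis using that by blast
qed

section \<open>The sampled program, its dual solution and approximate primal solutions\<close>

lemma mdp_matrix_nth:
  "mdp_matrix \<theta> P $ i $ t = (if i = snd t then 1 else 0) - \<theta> * P (snd t) (fst t) i"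
  by (simp add: mdp_matrix_def mat_def trans_matrix_def)

lemma inner_column_mdp_matrix:
  "column t (mdp_matrix \<theta> P) \<bullet> p
    = p $ snd t - \<theta> * (\<Sum>s'\<in>UNIV. P (snd t) (fst t) s' * p $ s')"
  by (simp add: inner_vec_def column_def mdp_matrix_nth left_diff_distrib sum_subtractf
      if_distrib[of "\<lambda>x. x * _"] sum_distrib_left mult.assoc cong: if_cong)

lemma select_columns_mult:
  "select_columns A J *v y = (\<Sum>k\<in>UNIV. y $ k *\<^sub>R column (J k) A)"
  by (simp add: vec_eq_iff matrix_vector_mult_def select_columns_def column_def mult.commute)

lemma inner_select_entries:
  "select_entries c J \<bullet> y = (\<Sum>k\<in>UNIV. c $ J k * y $ k)"
  by (simp add: inner_vec_def select_entries_def)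

lemma norm_column_mdp_matrix_le:
  fixes P :: "'s::finite \<Rightarrow> 'a::finite \<Rightarrow> 's \<Rightarrow> real"
  assumes P: "\<And>s a s'. 0 \<le> P s a s'" "\<And>s a. (\<Sum>s'\<in>UNIV. P s a s') = 1"
    and \<theta>: "0 < \<theta>" "\<theta> < 1"
  shows "norm (column t (mdp_matrix \<theta> P)) \<le> sqrt (real CARD('s))"
proof -
  have "\<bar>mdp_matrix \<theta> P $ i $ t\<bar> \<le> 1" for i
  proof -
    have "P (snd t) (fst t) i \<le> (\<Sum>s'\<in>UNIV. P (snd t) (fst t) s')"
      by (rule member_le_sum) (auto simp: P)
    then have "0 \<le> \<theta> * P (snd t) (fst t) i" "\<theta> * P (snd t) (fst t) i \<le> 1"
      using P \<theta> by (auto intro: mult_le_one)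
    then show ?thesis by (auto simp: mdp_matrix_nth)
  qed
  then have "(\<Sum>i\<in>UNIV. (column t (mdp_matrix \<theta> P) $ i)\<^sup>2) \<le> (\<Sum>i::'s\<in>UNIV. 1)"
    by (intro sum_mono) (simp add: column_def abs_square_le_1)
  then show ?thesis by (simp add: norm_vec_def L2_set_def)
qed

text \<open>Row \<open>s\<close> of the constraint matrix is nonpositive outside the columns
  belonging to state \<open>s\<close>. If none of those is sampled, a nonnegative combination cannot
  produce the entry 1.\<close>

lemma surj_state_if_sampled_feasible:
  fixes P :: "'s::finite \<Rightarrow> 'a::finite \<Rightarrow> 's \<Rightarrow> real" and J :: "'k::finite \<Rightarrow> 'a \<times> 's"
  assumes P: "\<And>s a s'. 0 \<le> P s a s'" and "0 < \<theta>"
    and "lp_feasible (select_columns (mdp_matrix \<theta> P) J) 1 \<noteq> {}"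
  shows "surj (\<lambda>k. snd (J k))"
proof (rule ccontr)
  assume "\<not> surj (\<lambda>k. snd (J k))"
  then obtain s where s: "\<And>k. snd (J k) \<noteq> s" by (metis surj_def)
  obtain y where y: "select_columns (mdp_matrix \<theta> P) J *v y = 1" "0 \<le> y"
    using assms(3) by (auto simp: lp_feasible_def)
  have "1 = (\<Sum>k\<in>UNIV. y $ k * mdp_matrix \<theta> P $ s $ J k)"
    using arg_cong[OF y(1), of "\<lambda>v. v $ s"]
    by (simp add: select_columns_mult column_def)
  also have "\<dots> \<le> 0"
    using y(2) P \<open>0 < \<theta>\<close> s[symmetric]
    by (intro sum_nonpos mult_nonneg_nonpos) (simp_all add: mdp_matrix_nth less_eq_vec_def)
  finally show False by simp
qed

text \<open>The Bellman inequalities are exactly dual feasibility for the sampled columns. They are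
  equalities on the columns chosen by the greedy policy \<pi>, and the occupancy of \<pi> is a
  primal feasible point supported there, so complementary slackness gives it the objective value
  \<open>1 \<bullet> p\<close>.\<close>

lemma sampled_dual_solution:
  fixes P :: "'s::finite \<Rightarrow> 'a::finite \<Rightarrow> 's \<Rightarrow> real" and J :: "'k::finite \<Rightarrow> 'a \<times> 's"
  assumes P: "\<And>s a s'. 0 \<le> P s a s'" "\<And>s a. (\<Sum>s'\<in>UNIV. P s a s') = 1"
    and \<theta>: "0 < \<theta>" "\<theta> < 1"
    and feas: "lp_feasible (select_columns (mdp_matrix \<theta> P) J) 1 \<noteq> {}"
  obtains p :: "real ^ 's"
  where "\<And>s. \<bar>p $ s\<bar> \<le> infnorm (mdp_cost c) / (1 - \<theta>)"
    and "\<And>k. column (J k) (mdp_matrix \<theta> P) \<bullet> p \<le> mdp_cost c $ J k"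
    and "v_sampled \<theta> P c J \<le> ereal (1 \<bullet> p)"
proof -
  define Q where "Q k = P (snd (J k)) (fst (J k))" for k
  have Q: "\<And>k s. 0 \<le> Q k s" "\<And>k. (\<Sum>s\<in>UNIV. Q k s) = 1"
    by (simp_all add: Q_def P)
  have surj: "surj (\<lambda>k. snd (J k))"
    by (rule surj_state_if_sampled_feasible[OF P(1) \<theta>(1) feas])
  have cost: "\<bar>mdp_cost c $ J k\<bar> \<le> infnorm (mdp_cost c)" for k
    by (rule component_le_infnorm_cart)
  obtain p \<pi> where \<pi>: "\<And>s. snd (J (\<pi> s)) = s"
    and eq: "\<And>s. p $ s = mdp_cost c $ J (\<pi> s) + \<theta> * (\<Sum>s'\<in>UNIV. Q (\<pi> s) s' * p $ s')"
    and le: "\<And>k. p $ snd (J k) \<le> mdp_cost c $ J k + \<theta> * (\<Sum>s'\<in>UNIV. Q k s' * p $ s')"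
    and bound: "\<And>s. \<bar>p $ s\<bar> \<le> infnorm (mdp_cost c) / (1 - \<theta>)"
    by (rule Bellman_equation[OF surj Q \<theta> cost]) (rule that)
  obtain x :: "real ^ 's" where x: "\<And>i. 0 \<le> x $ i"
    and xeq: "\<And>i. x $ i = 1 + \<theta> * (\<Sum>s\<in>UNIV. Q (\<pi> s) i * x $ s)"
    by (rule discounted_occupancy_exists[of "\<lambda>s. Q (\<pi> s)", OF Q \<theta>]) (rule that)
  \<comment> \<open>The weight of each state goes to the single index that \<pi> selects for it.
    Testing the index rather than the column \<open>J k\<close> keeps a column sampled several times
    from being counted more than once.\<close>
  define y :: "real ^ 'k" where "y = (\<chi> k. if k = \<pi> (snd (J k)) then x $ snd (J k) else 0)"
  have y_sum: "(\<Sum>k\<in>UNIV. y $ k *\<^sub>R g k) = (\<Sum>s\<in>UNIV. x $ s *\<^sub>R g (\<pi> s))"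
    for g :: "'k \<Rightarrow> 'v::real_vector"
  proof -
    have "(\<Sum>s\<in>UNIV. x $ s *\<^sub>R g (\<pi> s)) = (\<Sum>s\<in>UNIV. y $ \<pi> s *\<^sub>R g (\<pi> s))"
      by (simp add: y_def \<pi>)
    also have "\<dots> = (\<Sum>k\<in>range \<pi>. y $ k *\<^sub>R g k)"
      by (subst sum.reindex) (auto intro: inj_on_inverseI \<pi>)
    also have "\<dots> = (\<Sum>k\<in>UNIV. y $ k *\<^sub>R g k)"
      by (rule sum.mono_neutral_left) (auto simp: y_def)
    finally show ?thesis ..
  qed
  have "select_columns (mdp_matrix \<theta> P) J *v y = 1"
  proof -
    have "(\<Sum>s\<in>UNIV. x $ s * mdp_matrix \<theta> P $ i $ J (\<pi> s)) = 1" for i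
    proof -
      have "(\<Sum>s\<in>UNIV. x $ s * mdp_matrix \<theta> P $ i $ J (\<pi> s))
        = (\<Sum>s\<in>UNIV. (if i = s then x $ s else 0) - \<theta> * (Q (\<pi> s) i * x $ s))"
        by (intro sum.cong) (auto simp: mdp_matrix_nth \<pi> Q_def algebra_simps)
      also have "\<dots> = x $ i - \<theta> * (\<Sum>s\<in>UNIV. Q (\<pi> s) i * x $ s)"
        by (simp add: sum_subtractf flip: sum_distrib_left)
      finally show ?thesis using xeq[of i] by simp
    qed
    then show ?thesis
      by (simp add: select_columns_mult y_sum vec_eq_iff column_def)
  qed
  moreover have "0 \<le> y" by (simp add: less_eq_vec_def y_def x)
  ultimately have "y \<in> lp_feasible (select_columns (mdp_matrix \<theta> P) J) 1"
    by (simp add: lp_feasible_def)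
  then have "v_sampled \<theta> P c J \<le> ereal (select_entries (mdp_cost c) J \<bullet> y)"
    unfolding v_sampled_def lp_value_def by (rule INF_lower)
  also have "select_entries (mdp_cost c) J \<bullet> y = 1 \<bullet> p"
  proof -
    have "column (J (\<pi> s)) (mdp_matrix \<theta> P) \<bullet> p = mdp_cost c $ J (\<pi> s)" for s
      using eq[of s] by (simp add: inner_column_mdp_matrix \<pi> Q_def)
    then have "select_entries (mdp_cost c) J \<bullet> y
      = (\<Sum>k\<in>UNIV. y $ k *\<^sub>R column (J k) (mdp_matrix \<theta> P)) \<bullet> p"
      using y_sum[of "\<lambda>k. mdp_cost c $ J k"]
      by (simp add: y_sum inner_select_entries inner_sum_left mult.commute)
    then show ?thesis
      using \<open>select_columns _ J *v y = 1\<close> by (simp add: select_columns_mult)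
  qed
  finally have "v_sampled \<theta> P c J \<le> ereal (1 \<bullet> p)" .
  moreover have "column (J k) (mdp_matrix \<theta> P) \<bullet> p \<le> mdp_cost c $ J k" for k
    using le[of k] by (simp add: inner_column_mdp_matrix Q_def)
  ultimately show ?thesis using bound that by blast
qed

text \<open>Pairing the dual solution \<open>p\<close> with an arbitrary nonnegative
  \<open>y\<close> gives \<open>(A_J y) \<bullet> p \<le> c_J \<bullet> y\<close>. Replacing
  \<open>A_J y\<close> by the right-hand side 1 costs at most the norm of \<open>p\<close> times the
  residual, by Cauchy-Schwarz. The factor \<open>sqrt n_s\<close> converts the componentwise bound
  on \<open>p\<close> into a Euclidean one.\<close>

lemma v_sampled_le_approximate_solution:
  fixes P :: "'s::finite \<Rightarrow> 'a::finite \<Rightarrow> 's \<Rightarrow> real" and J :: "'k::finite \<Rightarrow> 'a \<times> 's"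
  assumes P: "\<And>s a s'. 0 \<le> P s a s'" "\<And>s a. (\<Sum>s'\<in>UNIV. P s a s') = 1"
    and \<theta>: "0 < \<theta>" "\<theta> < 1"
    and feas: "lp_feasible (select_columns (mdp_matrix \<theta> P) J) 1 \<noteq> {}"
    and "0 \<le> y"
  shows "v_sampled \<theta> P c J \<le> ereal (select_entries (mdp_cost c) J \<bullet> y
    + sqrt (real CARD('s)) * (infnorm (mdp_cost c) / (1 - \<theta>))
      * norm (select_columns (mdp_matrix \<theta> P) J *v y - 1))"
proof -
  define L where "L = infnorm (mdp_cost c) / (1 - \<theta>)"
  define e where "e = select_columns (mdp_matrix \<theta> P) J *v y - 1"
  obtain p :: "real ^ 's" where p: "\<And>s. \<bar>p $ s\<bar> \<le> L"
    "\<And>k. column (J k) (mdp_matrix \<theta> P) \<bullet> p \<le> mdp_cost c $ J k"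
    "v_sampled \<theta> P c J \<le> ereal (1 \<bullet> p)"
    using sampled_dual_solution[OF P \<theta> feas] unfolding L_def by metis
  have "0 \<le> L" using \<theta> by (simp add: L_def infnorm_pos_le)
  have "(\<Sum>s\<in>UNIV. (p $ s)\<^sup>2) \<le> (\<Sum>s::'s\<in>UNIV. L\<^sup>2)"
    by (intro sum_mono) (metis abs_ge_zero p(1) power2_abs power_mono)
  then have "norm p \<le> sqrt (real CARD('s) * L\<^sup>2)"
    by (simp add: norm_vec_def L2_set_def)
  then have norm_p: "norm p \<le> sqrt (real CARD('s)) * L"
    using \<open>0 \<le> L\<close> by (simp add: real_sqrt_mult)
  have "(e + 1) \<bullet> p \<le> select_entries (mdp_cost c) J \<bullet> y"
    using \<open>0 \<le> y\<close> p(2)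
    by (auto simp: e_def select_columns_mult inner_select_entries inner_sum_left mult.commute
        less_eq_vec_def intro!: sum_mono mult_left_mono)
  moreover have "- (e \<bullet> p) \<le> norm p * norm e"
    using Cauchy_Schwarz_ineq2[of e p] by (simp add: abs_le_iff mult.commute)
  moreover have "norm p * norm e \<le> sqrt (real CARD('s)) * L * norm e"
    by (intro mult_right_mono norm_p) simp
  ultimately have "1 \<bullet> p \<le> select_entries (mdp_cost c) J \<bullet> y + sqrt (real CARD('s)) * L * norm e"
    by (simp add: inner_add_left)
  then show ?thesis
    using p(3) by (auto simp: L_def e_def intro: order_trans)
qed

section \<open>Importance weights and the resulting probability bound\<close>

theorem mainTheorem8:
  fixes P :: "'s::finite \<Rightarrow> 'a::finite \<Rightarrow> 's \<Rightarrow> real"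
    and c :: "'s \<Rightarrow> 'a \<Rightarrow> real"
    and \<theta> C \<delta> :: real
    and \<xi> :: "real ^ ('a \<times> 's)"
    and M :: "'w measure"
    and j :: "'k::finite \<Rightarrow> 'w \<Rightarrow> 'a \<times> 's"
  assumes "\<And>s a s'. 0 \<le> P s a s'"
    and "\<And>s a. (\<Sum>s'\<in>UNIV. P s a s') = 1"
    and "0 < \<theta>" and "\<theta> < 1"
    and "norm (mdp_cost c) = 1"
    and "0 < C"
    and "\<And>t. 0 \<le> \<xi> $ t" and "(\<Sum>t\<in>UNIV. \<xi> $ t) = 1"
    and "prob_space M"
    and "prob_space.indep_vars M (\<lambda>_. count_space UNIV) j UNIV"
    and "\<And>k t. measure M {\<omega> \<in> space M. j k \<omega> = t} = \<xi> $ t"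
    and "0 < \<delta>" and "\<delta> < 1"
  shows "measure M {\<omega> \<in> space M.
      lp_feasible (select_columns (mdp_matrix \<theta> P) (\<lambda>k. j k \<omega>)) 1 \<noteq> {}
      \<and> rank (select_columns (mdp_matrix \<theta> P) (\<lambda>k. j k \<omega>)) = CARD('s)
      \<longrightarrow> v_sampled \<theta> P c (\<lambda>k. j k \<omega>) - v_P \<theta> P c
        \<le> (v_distr \<theta> P c C \<xi> - v_P \<theta> P c)
          + ereal (C / sqrt (real CARD('k))
              * (1 + real CARD('s) * infnorm (mdp_cost c) / (1 - \<theta>))
              * (1 + sqrt (2 * ln (2 / \<delta>))))}
    \<ge> 1 - \<delta>"
proof -
  interpret prob_space M by fact
  define K where "K = real CARD('k)"
  define n where "n = real CARD('s)"
  define L where "L = infnorm (mdp_cost c) / (1 - \<theta>)"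
  define B where "B = C / sqrt K * (1 + n * infnorm (mdp_cost c) / (1 - \<theta>))
    * (1 + sqrt (2 * ln (2 / \<delta>)))"
  \<comment> \<open>Stated for a fixed sample vector \<open>J\<close>, so that its probability can
    be computed under the product distribution.\<close>
  define good where "good J \<longleftrightarrow>
      (lp_feasible (select_columns (mdp_matrix \<theta> P) J) 1 \<noteq> {}
        \<and> rank (select_columns (mdp_matrix \<theta> P) J) = CARD('s)
      \<longrightarrow> v_sampled \<theta> P c J - v_P \<theta> P c \<le> (v_distr \<theta> P c C \<xi> - v_P \<theta> P c) + ereal B)"
    for J :: "'k \<Rightarrow> 'a \<times> 's"
  have "0 \<le> L" using assms(4) by (simp add: L_def infnorm_pos_le)
  have "0 < K" "0 < n" by (simp_all add: K_def n_def)
  have "1 - \<delta> \<le> prob {\<omega> \<in> space M. good (\<lambda>k. j k \<omega>)}"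
  \<comment> \<open>An infeasible box program has value \<infinity>, and the bound is then trivial
    for every sample.\<close>
  proof (cases "box_feasible (mdp_matrix \<theta> P) 1 (C *\<^sub>R \<xi>) = {}")
    case True
    then have "v_distr \<theta> P c C \<xi> = \<infinity>"
      by (simp add: v_distr_def lp_value_def top_ereal_def)
    then have "good J" for J
      unfolding good_def by (intro impI ereal_minus_le_minus_add) simp
    then show ?thesis using \<open>0 < \<delta>\<close> by (simp add: prob_space)
  next
    case False
    then obtain x where x: "x \<in> box_feasible (mdp_matrix \<theta> P) 1 (C *\<^sub>R \<xi>)"
      and v_distr: "v_distr \<theta> P c C \<xi> = ereal (mdp_cost c \<bullet> x)"
      by (rule v_distr_attained)
    have x_bounds: "0 \<le> x $ t" "x $ t \<le> C * \<xi> $ t" for t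
      using x by (simp_all add: box_feasible_def less_eq_vec_def del: split_paired_All)
    define q where "q = embed_pmf (\<lambda>t. \<xi> $ t)"
    have q: "pmf q t = \<xi> $ t" for t
      unfolding q_def using assms(7,8)
      by (intro pmf_embed_pmf)
        (auto simp: nn_integral_count_space_finite sum_ennreal simp flip: ennreal_1)
    \<comment> \<open>Importance weights: averaging \<open>z t * f t\<close> over \<xi> gives the
      sum of \<open>x $ t * f t\<close>, and the box constraint turns into the uniform bound
      \<open>z t \<le> C\<close>.\<close>
    define z where "z t = x $ t / \<xi> $ t" for t
    have z: "0 \<le> z t" "z t \<le> C" for t
      using x_bounds[of t] assms(6,7) by (auto simp: z_def divide_le_eq order_less_le)
    \<comment> \<open>If \<open>\<xi> $ t = 0\<close>, the box constraint forces \<open>x $ t = 0\<close>, so the junk value \<open>z t = 0\<close> is harmless.\<close>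
    have \<xi>z: "\<xi> $ t * z t = x $ t" for t
      using x_bounds[of t] by (cases "\<xi> $ t = 0") (auto simp: z_def)
    define u where "u t = z t * mdp_cost c $ t" for t
    define v where "v t = z t *\<^sub>R column t (mdp_matrix \<theta> P)" for t
    have E_u: "measure_pmf.expectation q u = mdp_cost c \<bullet> x"
      by (subst integral_measure_pmf[of UNIV])
        (auto simp: q u_def inner_vec_def mult.commute simp flip: \<xi>z intro!: sum.cong)
    have "measure_pmf.expectation q v = mdp_matrix \<theta> P *v x"
      by (subst integral_measure_pmf[of UNIV])
        (auto simp: q v_def matrix_mult_sum \<xi>z scalar_mult_eq_scaleR)
    then have E_v: "measure_pmf.expectation q v = 1"
      using x by (simp add: box_feasible_def)
    have "norm (u t) \<le> C" for t
    proof -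
      have "\<bar>mdp_cost c $ t\<bar> \<le> 1"
        using component_le_norm_cart[of "mdp_cost c" t] assms(5) by simp
      then have "z t * \<bar>mdp_cost c $ t\<bar> \<le> C * 1"
        using z[of t] by (intro mult_mono) auto
      then show ?thesis using z[of t] by (simp add: u_def abs_mult)
    qed
    moreover have "norm (v t) \<le> C * sqrt n" for t
      using norm_column_mdp_matrix_le[OF assms(1-4), of t] z[of t]
      by (auto simp: v_def n_def intro!: mult_mono)
    moreover have "0 \<le> sqrt n * L" using \<open>0 \<le> L\<close> \<open>0 < n\<close> by simp
    \<comment> \<open>The leading 1 comes from the entries of the cost vector, at most 1 by its
      normalization. The factor \<open>n\<close> is one \<open>sqrt n\<close> from the norm of the
      dual solution times one from the norm of a column.\<close>
    moreover have S: "C + sqrt n * L * (C * sqrt n) = C * (1 + n * L)"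
      using \<open>0 < n\<close> by (simp add: algebra_simps)
    moreover have "0 < C * (1 + n * L)"
      using \<open>0 < C\<close> \<open>0 < n\<close> \<open>0 \<le> L\<close> by (intro mult_pos_pos add_pos_nonneg) auto
    \<comment> \<open>Concentration at level \<open>\<delta> / 2\<close> produces the constant
      \<open>ln (2 / \<delta>)\<close>; the probability obtained exceeds the required
      \<open>1 - \<delta>\<close>.\<close>
    ultimately have "1 - \<delta> / 2 \<le> measure_pmf.prob (Pi_pmf UNIV undefined (\<lambda>_. q))
        {J :: 'k \<Rightarrow> _. norm ((\<Sum>k\<in>UNIV. u (J k)) /\<^sub>R K - mdp_cost c \<bullet> x)
            + sqrt n * L * norm ((\<Sum>k\<in>UNIV. v (J k)) /\<^sub>R K - 1)
          < C * (1 + n * L) / sqrt K * (1 + sqrt (2 * ln (1 / (\<delta> / 2))))}"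
      using mean_deviations_concentration[of u C v "C * sqrt n" "sqrt n * L" "\<delta> / 2" undefined q,
          where 'k = 'k] \<open>0 < \<delta>\<close> \<open>\<delta> < 1\<close>
      unfolding E_u E_v K_def by simp
    also have "\<dots> \<le> measure_pmf.prob (Pi_pmf UNIV undefined (\<lambda>_. q)) {J. good J}"
    proof (intro measure_pmf.finite_measure_mono subsetI)
      fix J :: "'k \<Rightarrow> 'a \<times> 's"
      assume "J \<in> {J. norm ((\<Sum>k\<in>UNIV. u (J k)) /\<^sub>R K - mdp_cost c \<bullet> x)
            + sqrt n * L * norm ((\<Sum>k\<in>UNIV. v (J k)) /\<^sub>R K - 1)
          < C * (1 + n * L) / sqrt K * (1 + sqrt (2 * ln (1 / (\<delta> / 2))))}"
      then have dev: "norm ((\<Sum>k\<in>UNIV. u (J k)) /\<^sub>R K - mdp_cost c \<bullet> x)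
            + sqrt n * L * norm ((\<Sum>k\<in>UNIV. v (J k)) /\<^sub>R K - 1) < B"
        by (simp add: B_def L_def)
      \<comment> \<open>With these weights \<open>A_J y\<close> and \<open>c_J \<bullet> y\<close>
        are the sample averages of \<open>v\<close> and \<open>u\<close>, so the residual and the
        cost error are the two deviations in \<open>dev\<close>.\<close>
      define y where "y = (\<chi> k. z (J k) / K)"
      have y: "0 \<le> y" using z \<open>0 < K\<close> by (simp add: less_eq_vec_def y_def)
      have Ay: "select_columns (mdp_matrix \<theta> P) J *v y = (\<Sum>k\<in>UNIV. v (J k)) /\<^sub>R K"
        by (simp add: select_columns_mult y_def v_def scaleR_sum_right divide_inverse mult.commute)
      have cy: "select_entries (mdp_cost c) J \<bullet> y = (\<Sum>k\<in>UNIV. u (J k)) /\<^sub>R K"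
        by (simp add: inner_select_entries y_def u_def sum_distrib_left field_simps)
      show "J \<in> {J. good J}"
        unfolding good_def mem_Collect_eq
      proof (intro impI ereal_minus_le_minus_add)
        assume "lp_feasible (select_columns (mdp_matrix \<theta> P) J) 1 \<noteq> {}
          \<and> rank (select_columns (mdp_matrix \<theta> P) J) = CARD('s)"
        then have "v_sampled \<theta> P c J \<le> ereal ((\<Sum>k\<in>UNIV. u (J k)) /\<^sub>R K
            + sqrt n * L * norm ((\<Sum>k\<in>UNIV. v (J k)) /\<^sub>R K - 1))"
          using v_sampled_le_approximate_solution[where P = P and J = J and c = c, OF assms(1-4) _ y]
          unfolding Ay cy L_def n_def by blast
        also have "\<dots> \<le> ereal (mdp_cost c \<bullet> x + B)"
          using dev by (simp add: abs_le_iff)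
        finally show "v_sampled \<theta> P c J \<le> v_distr \<theta> P c C \<xi> + ereal B"
          by (simp add: v_distr)
      qed
    qed simp
    also have "\<dots> = prob {\<omega> \<in> space M. good (\<lambda>k. j k \<omega>)}"
      by (rule indep_vars_prob_eq_Pi_pmf[symmetric, OF assms(10)]) (simp add: q assms(11))
    finally show ?thesis using \<open>0 < \<delta>\<close> by simp
  qed
  then show ?thesis unfolding good_def B_def K_def n_def .
qed

end
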